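(* Let $\mathbb{F}\in\{\mathbb{R},\mathbb{C}\}$, let $n$ be a positive integer and let $\|\cdot\|_{\mathbb{F}}$ be a norm on $\mathbb{F}^n$. Then for every $A\in\mathbb{F}^{n\times n}$, $$\rho(A)\le\|A\|_{\mathbb{F}}.$$
   Context: $\|A\|_{\mathbb{F}}=\max\{\|A\mathbf{x}\|_{\mathbb{F}} : \mathbf{x}\in\mathbb{F}^n,\ \|\mathbf{x}\|_{\mathbb{F}}\le 1\}$ is the operator norm induced by the given norm on $\mathbb{F}^n$ (for $\mathbb{F}=\mathbb{R}$ the maximum is over real vectors only). $\rho(A)$ is the spectral radius of $A$: the maximum modulus of all real and complex eigenvalues of $A$ (complex eigenvalues are included also when $\mathbb{F}=\mathbb{R}$). *)

theory Defs
  imports "Jordan_Normal_Form.Spectral_Radius"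
begin

definition norm_on_vec :: "nat \<Rightarrow> ('a::real_normed_field vec \<Rightarrow> real) \<Rightarrow> bool" where
  "norm_on_vec n N \<longleftrightarrow>
     (\<forall>x \<in> carrier_vec n. 0 \<le> N x) \<and>
     (\<forall>x \<in> carrier_vec n. N x = 0 \<longleftrightarrow> x = 0\<^sub>v n) \<and>
     (\<forall>c. \<forall>x \<in> carrier_vec n. N (c \<cdot>\<^sub>v x) = norm c * N x) \<and>
     (\<forall>x \<in> carrier_vec n. \<forall>y \<in> carrier_vec n. N (x + y) \<le> N x + N y)"

text \<open>
  The maximum is over an infinite set of values, so it is written with
  \<^const>\<open>Greatest\<close> (\<open>Max\<close> is meant for finite sets). It is attained
  whenever \<open>N\<close> is a norm, since the unit ball of \<open>N\<close> is then compact. The vectors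
  range over the field of the entries of \<open>A\<close>, so for a real matrix only real
  vectors are considered.
\<close>

definition operator_norm :: "nat \<Rightarrow> ('a::real_normed_field vec \<Rightarrow> real) \<Rightarrow> 'a mat \<Rightarrow> real" where
  "operator_norm n N A =
     (GREATEST r. \<exists>x \<in> carrier_vec n. N x \<le> 1 \<and> r = N (A *\<^sub>v x))"

end

theory Submission
  imports "HOL-Analysis.Function_Topology" "HOL-Analysis.Topology_Euclidean_Space" Defs
begin

unbundle no vec_syntax

text \<open>
  Since the unit ball of \<open>N\<close> is compact, the operator norm is attained and
  \<open>N (A x) \<le> \<parallel>A\<parallel> N x\<close>. For complex scalars this is applied to an eigenvector. For a
  real matrix with a complex eigenvector \<open>v\<close> and eigenvalue \<open>\<lambda>\<close>, choose \<open>c\<close> on the unit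
  circle maximizing \<open>N (Re (c v))\<close>; with \<open>d = c \<bar>\<lambda>\<bar> / \<lambda>\<close> one has
  \<open>\<bar>\<lambda>\<bar> N (Re (c v)) = N (A (Re (d v))) \<le> \<parallel>A\<parallel> N (Re (d v)) \<le> \<parallel>A\<parallel> N (Re (c v))\<close>.
\<close>

section \<open>Continuity of a norm in the coordinates\<close>

lemma norm_on_vecD:
  assumes "norm_on_vec n N"
  shows norm_on_vec_nonneg: "x \<in> carrier_vec n \<Longrightarrow> 0 \<le> N x"
    and norm_on_vec_eq_0_iff: "x \<in> carrier_vec n \<Longrightarrow> N x = 0 \<longleftrightarrow> x = 0\<^sub>v n"
    and norm_on_vec_smult: "x \<in> carrier_vec n \<Longrightarrow> N (c \<cdot>\<^sub>v x) = norm c * N x"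
    and norm_on_vec_triangle:
      "x \<in> carrier_vec n \<Longrightarrow> y \<in> carrier_vec n \<Longrightarrow> N (x + y) \<le> N x + N y"
  using assms unfolding norm_on_vec_def by auto

lemma norm_on_vec_le_sum:
  fixes N :: "'a::real_normed_field vec \<Rightarrow> real"
  assumes N: "norm_on_vec n N"
  shows "N (vec n f) \<le> (\<Sum>i<n. norm (f i) * N (unit_vec n i))"
proof -
  \<comment> \<open>The induction is on the number \<open>k\<close> of coordinates kept, not on the
    dimension: \<open>N\<close> is a norm in dimension \<open>n\<close> only.\<close>
  have "N (vec n (\<lambda>i. if i < k then f i else 0)) \<le> (\<Sum>i<k. norm (f i) * N (unit_vec n i))"
    if "k \<le> n" for k
    using that
  proof (induction k)
    case 0
    have "vec n (\<lambda>i. if i < 0 then f i else 0) = 0\<^sub>v n" by auto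
    then show ?case using norm_on_vec_eq_0_iff[OF N, of "0\<^sub>v n"] by simp
  next
    case (Suc k)
    let ?v = "vec n (\<lambda>i. if i < k then f i else 0)"
    have "vec n (\<lambda>i. if i < Suc k then f i else 0) = ?v + f k \<cdot>\<^sub>v unit_vec n k"
      using Suc.prems by (intro eq_vecI) (auto simp: less_Suc_eq)
    also have "N \<dots> \<le> N ?v + N (f k \<cdot>\<^sub>v unit_vec n k)"
      by (intro norm_on_vec_triangle[OF N]) auto
    also have "N (f k \<cdot>\<^sub>v unit_vec n k) = norm (f k) * N (unit_vec n k)"
      by (intro norm_on_vec_smult[OF N]) auto
    finally show ?case using Suc by simp
  qed
  moreover have "vec n (\<lambda>i. if i < n then f i else 0) = vec n f" by auto
  ultimately show ?thesis using order_refl[of n] by fastforce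
qed

text \<open>Reverse triangle inequality: \<open>N\<close> is Lipschitz for a weighted l1 norm of the
  coordinates, which is the source of its continuity.\<close>

lemma norm_on_vec_diff_le:
  fixes N :: "'a::real_normed_field vec \<Rightarrow> real"
  assumes N: "norm_on_vec n N"
  shows "\<bar>N (vec n f) - N (vec n g)\<bar> \<le> (\<Sum>i<n. norm (f i - g i) * N (unit_vec n i))"
proof -
  have *: "N (vec n f) - N (vec n g) \<le> (\<Sum>i<n. norm (f i - g i) * N (unit_vec n i))" for f g
  proof -
    have "vec n f = vec n (\<lambda>i. f i - g i) + vec n g" by auto
    then have "N (vec n f) \<le> N (vec n (\<lambda>i. f i - g i)) + N (vec n g)"
      using norm_on_vec_triangle[OF N] by (metis vec_carrier)
    then show ?thesis using norm_on_vec_le_sum[OF N, of "\<lambda>i. f i - g i"] by linarith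
  qed
  show ?thesis using *[of f g] *[of g f] by (simp add: norm_minus_commute abs_le_iff)
qed

text \<open>The parameter \<open>t\<close> is arbitrary, so that it can later be a coefficient
  function or a point of the complex unit circle.\<close>

lemma continuous_on_norm_on_vec:
  fixes N :: "'a::real_normed_field vec \<Rightarrow> real"
  assumes N: "norm_on_vec n N" and f: "\<And>i. i < n \<Longrightarrow> continuous_on S (\<lambda>t. f t i)"
  shows "continuous_on S (\<lambda>t. N (vec n (f t)))"
  unfolding continuous_on_def
proof
  fix s assume "s \<in> S"
  have "((\<lambda>t. \<Sum>i<n. norm (f t i - f s i) * N (unit_vec n i)) \<longlongrightarrow>
      (\<Sum>i<n. norm (f s i - f s i) * N (unit_vec n i))) (at s within S)"
    using f \<open>s \<in> S\<close> by (intro tendsto_intros) (auto simp: continuous_on_def)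
  then have "((\<lambda>t. \<Sum>i<n. norm (f t i - f s i) * N (unit_vec n i)) \<longlongrightarrow> 0) (at s within S)"
    by simp
  then have "((\<lambda>t. N (vec n (f t)) - N (vec n (f s))) \<longlongrightarrow> 0) (at s within S)"
    by (rule Lim_null_comparison[rotated])
      (intro always_eventually allI, simp add: norm_on_vec_diff_le[OF N])
  then show "((\<lambda>t. N (vec n (f t))) \<longlongrightarrow> N (vec n (f s))) (at s within S)"
    by (simp add: LIM_zero_iff)
qed

section \<open>Compactness and comparison with the maximum norm\<close>

text \<open>Vectors carry no topology, so compactness is obtained from Tychonoff's theorem for
  their coefficient functions, taken to be \<open>0\<close> from index \<open>n\<close> on.\<close>

definition coeff_box :: "nat \<Rightarrow> real \<Rightarrow> (nat \<Rightarrow> 'a::real_normed_field) set" where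
  "coeff_box n r = {f. (\<forall>i<n. norm (f i) \<le> r) \<and> (\<forall>i\<ge>n. f i = 0)}"

lemma compact_coeff_box:
  "compact (coeff_box n r :: (nat \<Rightarrow> 'a::{real_normed_field,heine_borel}) set)"
proof -
  have "f \<in> coeff_box n r \<longleftrightarrow> (\<forall>i. f i \<in> (if i < n then cball 0 r else {0 :: 'a}))" for f
    unfolding coeff_box_def by (simp add: not_less) (metis leD linorder_not_less)
  then have "coeff_box n r = PiE UNIV (\<lambda>i. if i < n then cball 0 r else {0 :: 'a})"
    by (simp only: set_eq_iff PiE_UNIV_domain Pi_iff UNIV_I simp_thms ball_simps)
  \<comment> \<open>Tychonoff: each factor is a closed ball, compact by Heine-Borel, or the
    singleton of \<open>0\<close> that the padding provides.\<close>
  moreover have "compactin (product_topology (\<lambda>i. euclidean) UNIV)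
      (PiE UNIV (\<lambda>i. if i < n then cball 0 r else {0 :: 'a}))"
    by (subst compactin_PiE) auto
  ultimately show ?thesis by (simp add: euclidean_product_topology)
qed

text \<open>One half of the equivalence of \<open>N\<close> with the maximum norm: \<open>m\<close>
  is the minimum of \<open>N\<close> on the unit sphere of the maximum norm, positive because it is
  attained at a nonzero vector. It makes the unit ball of \<open>N\<close> bounded.\<close>

lemma norm_on_vec_coercive:
  fixes N :: "'a::{real_normed_field,heine_borel} vec \<Rightarrow> real"
  assumes N: "norm_on_vec n N" and n: "n > 0"
  obtains m where "m > 0" "\<And>x i. x \<in> carrier_vec n \<Longrightarrow> i < n \<Longrightarrow> m * norm (x $ i) \<le> N x"
proof -
  \<comment> \<open>The unit sphere of the maximum norm, written as a compact box cut by a finite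
    union of closed sets.\<close>
  define S :: "(nat \<Rightarrow> 'a) set" where
    "S = coeff_box n 1 \<inter> (\<Union>i<n. {f. norm (f i) = 1})"
  have "closed {f :: nat \<Rightarrow> 'a. norm (f i) = 1}" for i
    by (intro closed_Collect_eq continuous_intros continuous_on_product_coordinates)
  then have "compact S"
    unfolding S_def by (intro compact_Int_closed compact_coeff_box closed_UN) auto
  moreover have "(\<lambda>i. if i < n then 1 else 0) \<in> S"
    using n by (auto simp: S_def coeff_box_def)
  moreover have "continuous_on S (\<lambda>f. N (vec n f))"
    by (intro continuous_on_norm_on_vec[OF N] continuous_on_subset[OF continuous_on_product_coordinates])
      auto
  ultimately obtain g where g: "g \<in> S" "\<And>f. f \<in> S \<Longrightarrow> N (vec n g) \<le> N (vec n f)"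
    using continuous_attains_inf[of S "\<lambda>f. N (vec n f)"] by blast
  obtain i where i: "i < n" "norm (g i) = 1" using g(1) by (auto simp: S_def)
  have "vec n g \<noteq> 0\<^sub>v n"
  proof
    assume "vec n g = 0\<^sub>v n"
    then have "vec n g $ i = 0" using i by simp
    then show False using i by simp
  qed
  then have pos: "N (vec n g) > 0"
    using norm_on_vec_nonneg[OF N, of "vec n g"] norm_on_vec_eq_0_iff[OF N, of "vec n g"]
    by (simp add: less_le)
  have "N (vec n g) * norm (x $ i) \<le> N x" if x: "x \<in> carrier_vec n" and i: "i < n" for x i
  proof -
    \<comment> \<open>\<open>M\<close> is the maximum norm of \<open>x\<close>; for \<open>x\<close>
      nonzero, scaling by \<open>1 / M\<close> moves \<open>x\<close> into \<open>S\<close>.\<close>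
    define M where "M = Max ((\<lambda>i. norm (x $ i)) ` {..<n})"
    have "M \<in> (\<lambda>i. norm (x $ i)) ` {..<n}"
      unfolding M_def using n by (intro Max_in) auto
    then obtain j where j: "j < n" "M = norm (x $ j)" by auto
    have le: "norm (x $ i) \<le> M" if "i < n" for i
      unfolding M_def using that by (intro Max_ge) auto
    show ?thesis
    proof (cases "M = 0")
      case True
      then show ?thesis using le[OF i] norm_on_vec_nonneg[OF N x] by simp
    next
      case False
      then have M: "M > 0" using j by simp
      let ?f = "\<lambda>i. if i < n then of_real (1 / M) * x $ i else 0"
      have "?f \<in> S"
        using M j le by (auto simp: S_def coeff_box_def norm_mult norm_divide)
      then have "N (vec n g) \<le> N (vec n ?f)" by (rule g(2))
      also have "vec n ?f = of_real (1 / M) \<cdot>\<^sub>v x" using x by auto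
      also have "N \<dots> = N x / M"
        using M x by (subst norm_on_vec_smult[OF N]) (auto simp: norm_divide)
      finally have "N (vec n g) * M \<le> N x" using M by (simp add: field_simps)
      moreover have "N (vec n g) * norm (x $ i) \<le> N (vec n g) * M"
        using pos le[OF i] by (intro mult_left_mono) auto
      ultimately show ?thesis by linarith
    qed
  qed
  then show ?thesis using that pos by blast
qed

section \<open>The operator norm as an attained maximum\<close>

lemma operator_norm_attained:
  fixes N :: "'a::{real_normed_field,heine_borel} vec \<Rightarrow> real"
  assumes N: "norm_on_vec n N" and n: "n > 0" and A: "A \<in> carrier_mat n n"
  obtains x where "x \<in> carrier_vec n" "N x \<le> 1" "operator_norm n N A = N (A *\<^sub>v x)"
    "\<And>y. y \<in> carrier_vec n \<Longrightarrow> N y \<le> 1 \<Longrightarrow> N (A *\<^sub>v y) \<le> N (A *\<^sub>v x)"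
proof -
  obtain m where m: "m > 0" "\<And>x i. x \<in> carrier_vec n \<Longrightarrow> i < n \<Longrightarrow> m * norm (x $ i) \<le> N x"
    using norm_on_vec_coercive[OF N n] by blast
  \<comment> \<open>Coercivity turns \<open>N x \<le> 1\<close> into coordinates of norm at most
    \<open>1 / m\<close>, so the box cuts off no vector of the unit ball.\<close>
  define K :: "(nat \<Rightarrow> 'a) set" where "K = coeff_box n (1 / m) \<inter> {f. N (vec n f) \<le> 1}"
  have coord: "continuous_on S (\<lambda>f :: nat \<Rightarrow> 'a. f i)" for S i
    by (rule continuous_on_subset[OF continuous_on_product_coordinates]) auto
  have "closed {f :: nat \<Rightarrow> 'a. N (vec n f) \<le> 1}"
    by (intro closed_Collect_le continuous_on_norm_on_vec[OF N] coord continuous_on_const)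
  then have "compact K"
    unfolding K_def by (intro compact_Int_closed compact_coeff_box)
  moreover have "(\<lambda>i. 0) \<in> K"
  proof -
    have "vec n (\<lambda>i. 0 :: 'a) = 0\<^sub>v n" by auto
    then show ?thesis
      using m(1) norm_on_vec_eq_0_iff[OF N, of "0\<^sub>v n"] by (simp add: K_def coeff_box_def)
  qed
  moreover have "continuous_on K (\<lambda>f. N (A *\<^sub>v vec n f))"
  proof -
    \<comment> \<open>Each coordinate of the image is a finite linear combination of the
      \<open>f j\<close>, hence continuous in \<open>f\<close>.\<close>
    have eq: "A *\<^sub>v vec n f = vec n (\<lambda>i. \<Sum>j<n. A $$ (i, j) * f j)" for f
      using A by (intro eq_vecI) (auto simp: scalar_prod_def atLeast0LessThan)
    show ?thesis
      unfolding eq by (intro continuous_on_norm_on_vec[OF N] continuous_intros coord)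
  qed
  ultimately obtain g where
    g: "g \<in> K" "\<And>f. f \<in> K \<Longrightarrow> N (A *\<^sub>v vec n f) \<le> N (A *\<^sub>v vec n g)"
    using continuous_attains_sup[of K "\<lambda>f. N (A *\<^sub>v vec n f)"] by blast
  have le: "N (A *\<^sub>v y) \<le> N (A *\<^sub>v vec n g)" if y: "y \<in> carrier_vec n" "N y \<le> 1" for y
  proof -
    let ?f = "\<lambda>i. if i < n then y $ i else 0"
    have eq: "vec n ?f = y" using y(1) by auto
    have "norm (y $ i) \<le> 1 / m" if "i < n" for i
      using m(2)[OF y(1) that] y(2) m(1) by (simp add: field_simps)
    then have "?f \<in> K" using eq y(2) by (simp add: K_def coeff_box_def)
    then show ?thesis using g(2) eq by metis
  qed
  moreover have "N (vec n g) \<le> 1" using g(1) by (simp add: K_def)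
  \<comment> \<open>A maximizer is known now, so \<open>Greatest\<close> takes its intended
    value.\<close>
  moreover from this have "operator_norm n N A = N (A *\<^sub>v vec n g)"
    unfolding operator_norm_def using le
    by (intro Greatest_equality bexI[of _ "vec n g"]) auto
  ultimately show ?thesis using that[of "vec n g"] by auto
qed

lemma operator_norm_nonneg:
  fixes N :: "'a::{real_normed_field,heine_borel} vec \<Rightarrow> real"
  assumes N: "norm_on_vec n N" and n: "n > 0" and A: "A \<in> carrier_mat n n"
  shows "0 \<le> operator_norm n N A"
proof -
  obtain x where "x \<in> carrier_vec n" "operator_norm n N A = N (A *\<^sub>v x)"
    using operator_norm_attained[OF N n A] by blast
  then show ?thesis using norm_on_vec_nonneg[OF N] A by simp
qed

lemma operator_norm_bound:
  fixes N :: "'a::{real_normed_field,heine_borel} vec \<Rightarrow> real"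
  assumes N: "norm_on_vec n N" and n: "n > 0" and A: "A \<in> carrier_mat n n"
    and x: "x \<in> carrier_vec n"
  shows "N (A *\<^sub>v x) \<le> operator_norm n N A * N x"
proof (cases "x = 0\<^sub>v n")
  case True
  have "A *\<^sub>v 0\<^sub>v n = 0\<^sub>v n" using A by auto
  then show ?thesis using True norm_on_vec_eq_0_iff[OF N, of "0\<^sub>v n"] by simp
next
  case False
  then have pos: "N x > 0"
    using norm_on_vec_nonneg[OF N x] norm_on_vec_eq_0_iff[OF N x] by simp
  let ?c = "of_real (1 / N x) :: 'a"
  have "N (?c \<cdot>\<^sub>v x) \<le> 1"
    using pos by (simp add: norm_on_vec_smult[OF N x] norm_divide)
  moreover obtain z where "operator_norm n N A = N (A *\<^sub>v z)"
    "\<And>y. y \<in> carrier_vec n \<Longrightarrow> N y \<le> 1 \<Longrightarrow> N (A *\<^sub>v y) \<le> N (A *\<^sub>v z)"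
    using operator_norm_attained[OF N n A] by blast
  ultimately have "N (A *\<^sub>v (?c \<cdot>\<^sub>v x)) \<le> operator_norm n N A"
    using x by simp
  moreover have "N (A *\<^sub>v (?c \<cdot>\<^sub>v x)) = N (A *\<^sub>v x) / N x"
    using pos A x by (simp add: mult_mat_vec[OF A x] norm_on_vec_smult[OF N] norm_divide)
  ultimately have "N (A *\<^sub>v x) / N x \<le> operator_norm n N A" by simp
  then show ?thesis using pos by (simp add: pos_divide_le_eq)
qed

section \<open>Eigenvalues and the spectral radius\<close>

text \<open>The eigenvector lies over the field of \<open>N\<close>, so
  \<open>operator_norm_bound\<close> applies to it directly. Over the reals this reaches only real
  eigenvalues.\<close>

lemma eigenvalue_norm_le_operator_norm:
  fixes N :: "'a::{real_normed_field,heine_borel} vec \<Rightarrow> real"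
  assumes N: "norm_on_vec n N" and n: "n > 0" and A: "A \<in> carrier_mat n n"
    and ev: "eigenvalue A k"
  shows "norm k \<le> operator_norm n N A"
proof -
  obtain v where v: "v \<in> carrier_vec n" "v \<noteq> 0\<^sub>v n" "A *\<^sub>v v = k \<cdot>\<^sub>v v"
    using ev A by (auto simp: eigenvalue_def eigenvector_def)
  have "norm k * N v \<le> operator_norm n N A * N v"
    using operator_norm_bound[OF N n A v(1)] norm_on_vec_smult[OF N v(1)] v(3) by simp
  moreover have "N v > 0"
    using norm_on_vec_nonneg[OF N v(1)] norm_on_vec_eq_0_iff[OF N v(1)] v(2) by simp
  ultimately show ?thesis by simp
qed

text \<open>\<open>N\<close> cannot be evaluated at a complex eigenvector. The maximum of
  \<open>N (Re (c v))\<close> over the unit circle replaces it: as a function of \<open>v\<close>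
  this is a norm on complex vectors that extends \<open>N\<close>.\<close>

lemma complex_eigenvalue_norm_le_operator_norm:
  fixes N :: "real vec \<Rightarrow> real"
  assumes N: "norm_on_vec n N" and n: "n > 0" and A: "A \<in> carrier_mat n n"
    and ev: "eigenvalue (map_mat complex_of_real A) k"
  shows "norm k \<le> operator_norm n N A"
proof (cases "k = 0")
  case True
  then show ?thesis using operator_norm_nonneg[OF N n A] by simp
next
  case k: False
  obtain v where v: "v \<in> carrier_vec n" "v \<noteq> 0\<^sub>v n" "map_mat complex_of_real A *\<^sub>v v = k \<cdot>\<^sub>v v"
    using ev A by (auto simp: eigenvalue_def eigenvector_def)
  define re where "re c = vec n (\<lambda>i. Re (c * v $ i))" for c
  have re_carrier: "re c \<in> carrier_vec n" for c by (simp add: re_def)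
  have "continuous_on (sphere 0 1) (\<lambda>c. N (re c))"
    unfolding re_def by (intro continuous_on_norm_on_vec[OF N] continuous_intros)
  moreover have "1 \<in> sphere (0 :: complex) 1" by simp
  ultimately obtain c where "c \<in> sphere 0 1" "\<forall>d\<in>sphere 0 1. N (re d) \<le> N (re c)"
    using continuous_attains_sup[OF compact_sphere, of "0 :: complex" 1 "\<lambda>c. N (re c)"] by blast
  then have c: "norm c = 1" "\<And>d. norm d = 1 \<Longrightarrow> N (re d) \<le> N (re c)" by simp_all
  \<comment> \<open>If the maximum were 0, the rotations by 1 and by the imaginary unit would kill
    the real and imaginary parts of \<open>v\<close>.\<close>
  have "N (re c) > 0"
  proof (rule ccontr)
    assume "\<not> N (re c) > 0"
    then have zero: "re d = 0\<^sub>v n" if "norm d = 1" for d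
      using c(2)[OF that] norm_on_vec_nonneg[OF N re_carrier, of d]
        norm_on_vec_eq_0_iff[OF N re_carrier, of d] by simp
    have "v $ i = 0" if i: "i < n" for i
    proof -
      have "re 1 $ i = 0" "re \<i> $ i = 0" using zero[of 1] zero[of \<i>] i by simp_all
      then show ?thesis using i by (simp add: re_def complex_eq_iff)
    qed
    then show False using v(1,2) by auto
  qed
  moreover have "norm k * N (re c) \<le> operator_norm n N A * N (re c)"
  proof -
    \<comment> \<open>Chosen so that \<open>d * k = c * norm k\<close>: applying \<open>A\<close>
      turns the rotation by \<open>d\<close> into the rotation by \<open>c\<close>, scaled by
      \<open>norm k\<close>.\<close>
    define d where "d = c * of_real (norm k) / k"
    have d: "norm d = 1" using c(1) k by (simp add: d_def norm_mult norm_divide)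
    have "A *\<^sub>v re d = norm k \<cdot>\<^sub>v re c"
    proof (intro eq_vecI)
      fix i assume "i < dim_vec (norm k \<cdot>\<^sub>v re c)"
      then have i: "i < n" by (simp add: re_def)
      have "(A *\<^sub>v re d) $ i = (\<Sum>j<n. A $$ (i, j) * Re (d * v $ j))"
        using A i by (simp add: re_def scalar_prod_def atLeast0LessThan)
      \<comment> \<open>Here the entries of \<open>A\<close> being real matters: multiplication by
        them commutes with \<open>Re\<close>.\<close>
      also have "\<dots> = Re (d * (\<Sum>j<n. of_real (A $$ (i, j)) * v $ j))"
        unfolding sum_distrib_left Re_sum by (intro sum.cong refl) (simp add: algebra_simps)
      also have "(\<Sum>j<n. of_real (A $$ (i, j)) * v $ j) = (map_mat complex_of_real A *\<^sub>v v) $ i"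
        using A i v(1) by (simp add: scalar_prod_def atLeast0LessThan)
      also have "\<dots> = k * v $ i" using v i by simp
      also have "d * (k * v $ i) = of_real (norm k) * (c * v $ i)"
        using k by (simp add: d_def)
      finally show "(A *\<^sub>v re d) $ i = (norm k \<cdot>\<^sub>v re c) $ i"
        using i by (simp add: re_def)
    qed (use A in \<open>simp add: re_def\<close>)
    then have "norm k * N (re c) = N (A *\<^sub>v re d)"
      by (simp add: norm_on_vec_smult[OF N re_carrier])
    also have "\<dots> \<le> operator_norm n N A * N (re d)"
      by (rule operator_norm_bound[OF N n A re_carrier])
    also have "\<dots> \<le> operator_norm n N A * N (re c)"
      using c(2)[OF d] operator_norm_nonneg[OF N n A] by (rule mult_left_mono)
    finally show ?thesis .
  qed
  ultimately show ?thesis by simp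
qed

text \<open>The spectral radius is itself the modulus of some eigenvalue; \<open>n > 0\<close> makes
  the spectrum nonempty.\<close>

lemma spectral_radius_le:
  assumes "A \<in> carrier_mat n n" "n > 0" "\<And>k. eigenvalue A k \<Longrightarrow> norm k \<le> r"
  shows "spectral_radius A \<le> r"
  using spectral_radius_mem_max(1)[OF assms(1,2)] assms(3) by (auto simp: spectrum_def)

theorem lemma2p1:
  fixes n :: nat
  assumes "n > 0"
  shows "(\<forall>(N :: real vec \<Rightarrow> real) (A :: real mat).
            norm_on_vec n N \<longrightarrow> A \<in> carrier_mat n n \<longrightarrow>
            spectral_radius (map_mat complex_of_real A) \<le> operator_norm n N A) \<and>
         (\<forall>(N :: complex vec \<Rightarrow> real) (A :: complex mat).
            norm_on_vec n N \<longrightarrow> A \<in> carrier_mat n n \<longrightarrow>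
            spectral_radius A \<le> operator_norm n N A)"
  using assms
  by (auto intro!: spectral_radius_le[of _ n] complex_eigenvalue_norm_le_operator_norm
      eigenvalue_norm_le_operator_norm)

end
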